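(* Let $D$ be an almost Dedekind domain with $\mathrm{Jac}(D)\neq(0)$. Then $D$ is not completely unbounded.
   Context: An almost Dedekind domain is an integral domain $D$ such that $D_M$ is a discrete valuation ring for every maximal ideal $M$ of $D$. $\mathrm{Jac}(D)$ is the Jacobson radical of $D$, the intersection of all maximal ideals of $D$. For a nonzero ideal $I$, let $\nu_I:\mathrm{Max}(D)\to\mathbb{Z}$, $\nu_I(M):=v_M(I)$, where $v_M$ is the valuation of $D_M$. A nonzero proper ideal $I$ of $D$ is bounded if $\nu_I$ is a bounded function. $D$ is completely unbounded if no nonzero proper principal ideal of $D$ is bounded. *)

theory Defs
  imports "HOL-Algebra.Ring_Divisibility"
begin

text \<open>
  The localization \<open>D\<^sub>M\<close> of a domain \<open>D\<close> at (the complement of) a prime ideal \<open>M\<close>, realised as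
  equivalence classes of pairs; \<open>loc_frac D M a s\<close> is the class of the fraction \<open>a / s\<close>.
  As \<open>D\<close> has no zero divisors, \<open>a / s = b / t\<close> is simply \<open>a t = b s\<close>.
\<close>

definition loc_pairs :: "('a, 'b) ring_scheme \<Rightarrow> 'a set \<Rightarrow> ('a \<times> 'a) set" where
  "loc_pairs D M = carrier D \<times> (carrier D - M)"

definition loc_frac :: "('a, 'b) ring_scheme \<Rightarrow> 'a set \<Rightarrow> 'a \<Rightarrow> 'a \<Rightarrow> ('a \<times> 'a) set" where
  "loc_frac D M a s = {(b, t) \<in> loc_pairs D M. a \<otimes>\<^bsub>D\<^esub> t = b \<otimes>\<^bsub>D\<^esub> s}"

text \<open>
  Sum and product of two classes are given on representatives; all members of the unions below
  coincide.
\<close>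

definition localization :: "('a, 'b) ring_scheme \<Rightarrow> 'a set \<Rightarrow> ('a \<times> 'a) set ring" where
  "localization D M =
    \<lparr>carrier = {loc_frac D M a s | a s. (a, s) \<in> loc_pairs D M},
     mult = (\<lambda>A B. \<Union>(a, s)\<in>A. \<Union>(b, t)\<in>B. loc_frac D M (a \<otimes>\<^bsub>D\<^esub> b) (s \<otimes>\<^bsub>D\<^esub> t)),
     one = loc_frac D M \<one>\<^bsub>D\<^esub> \<one>\<^bsub>D\<^esub>,
     zero = loc_frac D M \<zero>\<^bsub>D\<^esub> \<one>\<^bsub>D\<^esub>,
     add = (\<lambda>A B. \<Union>(a, s)\<in>A. \<Union>(b, t)\<in>B.
              loc_frac D M (a \<otimes>\<^bsub>D\<^esub> t \<oplus>\<^bsub>D\<^esub> b \<otimes>\<^bsub>D\<^esub> s) (s \<otimes>\<^bsub>D\<^esub> t))\<rparr>"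

definition discrete_valuation_ring :: "('a, 'b) ring_scheme \<Rightarrow> bool" where
  "discrete_valuation_ring V \<longleftrightarrow>
     principal_domain V \<and> \<not> field V \<and> (\<exists>!P. maximalideal P V)"

text \<open>
  The normalized valuation of a discrete valuation ring, on nonzero elements of the ring:
  the exponent \<open>n\<close> in \<open>x = u t\<^sup>n\<close>, with \<open>u\<close> a unit and \<open>t\<close> a generator of the maximal ideal.
\<close>

definition dvr_valuation :: "('a, 'b) ring_scheme \<Rightarrow> 'a \<Rightarrow> nat" where
  "dvr_valuation V x =
     (THE n. \<exists>t\<in>carrier V. \<exists>u\<in>Units V.
        maximalideal (PIdl\<^bsub>V\<^esub> t) V \<and> x = u \<otimes>\<^bsub>V\<^esub> (t [^]\<^bsub>V\<^esub> n))"

definition almost_dedekind_domain :: "('a, 'b) ring_scheme \<Rightarrow> bool" where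
  "almost_dedekind_domain D \<longleftrightarrow>
     domain D \<and> (\<forall>M. maximalideal M D \<longrightarrow> discrete_valuation_ring (localization D M))"

definition jacobson_radical :: "('a, 'b) ring_scheme \<Rightarrow> 'a set" where
  "jacobson_radical D = \<Inter>{M. maximalideal M D}"

text \<open>
  \<open>\<nu>\<^sub>I(M) = v\<^sub>M(I)\<close> is the minimum of \<open>v\<^sub>M(x)\<close> over the nonzero \<open>x \<in> I\<close>, where \<open>x\<close> is viewed as
  \<open>x / 1\<close> in \<open>D\<^sub>M\<close>; only meaningful for nonzero ideals \<open>I\<close> and maximal ideals \<open>M\<close>.
\<close>

definition ideal_valuation :: "('a, 'b) ring_scheme \<Rightarrow> 'a set \<Rightarrow> 'a set \<Rightarrow> int" where
  "ideal_valuation D I M =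
     int (INF x\<in>I - {\<zero>\<^bsub>D\<^esub>}. dvr_valuation (localization D M) (loc_frac D M x \<one>\<^bsub>D\<^esub>))"

definition bounded_ideal :: "('a, 'b) ring_scheme \<Rightarrow> 'a set \<Rightarrow> bool" where
  "bounded_ideal D I \<longleftrightarrow>
     ideal I D \<and> I \<noteq> {\<zero>\<^bsub>D\<^esub>} \<and> I \<noteq> carrier D \<and>
     (\<exists>B. \<forall>M. maximalideal M D \<longrightarrow> \<bar>ideal_valuation D I M\<bar> \<le> B)"

definition completely_unbounded :: "('a, 'b) ring_scheme \<Rightarrow> bool" where
  "completely_unbounded D \<longleftrightarrow>
     (\<forall>I. principalideal I D \<and> I \<noteq> {\<zero>\<^bsub>D\<^esub>} \<and> I \<noteq> carrier D \<longrightarrow> \<not> bounded_ideal D I)"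

end

theory Submission
  imports Defs
begin

text \<open>
  Fix a nonzero \<open>x\<close> in the Jacobson radical. The sets \<open>V(y) = {M. y \<in> M}\<close> of maximal ideals are then
  clopen, and \<open>{M. v\<^sub>M(x) \<ge> k}\<close> is open, because an equation \<open>s x = a t\<^sup>k\<close> with \<open>t \<in> M\<close>, \<open>s \<notin> M\<close> gives
  the same bound on the clopen set \<open>V(t) - V(s)\<close>. If \<open>x\<close> were unbounded on every nonempty \<open>V(e)\<close>, one
  could therefore shrink \<open>V(e)\<close> repeatedly, making \<open>v(x) \<ge> k\<close> on the \<open>k\<close>-th set, and compactness would
  produce a maximal ideal where \<open>x\<close> has infinite valuation. So \<open>v(x) \<le> n\<close> on some nonempty \<open>V(e)\<close>;
  if \<open>V(f)\<close> is the complement of \<open>V(e)\<close>, then \<open>e\<^sup>n\<^sup>+\<^sup>1 + f x\<close> generates a bounded proper ideal.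
\<close>

section \<open>Existence and basic properties of maximal ideals\<close>

text \<open>Zorn's lemma on the ideals above \<open>I\<close> that avoid \<open>\<one>\<close>:
  properness is expressed by \<open>\<one> \<notin> J\<close> because this condition passes to
  unions of chains.\<close>

lemma (in ring) exists_maximalideal_containing:
  assumes "ideal I R" and "\<one> \<notin> I"
  obtains M where "maximalideal M R" and "I \<subseteq> M"
proof -
  let ?A = "{J. ideal J R \<and> I \<subseteq> J \<and> \<one> \<notin> J}"
  have "\<exists>U\<in>?A. \<forall>X\<in>C. X \<subseteq> U" if C: "subset.chain ?A C" for C
  proof (cases "C = {}")
    \<comment> \<open>The union of the empty chain is not an ideal, so \<open>I\<close> itself
      serves as the upper bound.\<close>
    case True
    then show ?thesis using assms by auto
  next
    case False
    have "subset.chain {J. ideal J R} C"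
      using C unfolding subset.chain_def by auto
    then have "ideal (\<Union>C) R"
      using chain_Union_is_ideal[of C] False by simp
    then have "\<Union>C \<in> ?A"
      using C False unfolding subset.chain_def by auto
    then show ?thesis by blast
  qed
  then obtain M where M: "M \<in> ?A" and max: "\<forall>X\<in>?A. M \<subseteq> X \<longrightarrow> X = M"
    using subset_Zorn[of ?A] by auto
  have "maximalideal M R"
  proof (rule maximalidealI)
    show "ideal M R" using M by auto
    show "carrier R \<noteq> M" using M by auto
    fix J assume J: "ideal J R" "M \<subseteq> J" "J \<subseteq> carrier R"
    show "J = M \<or> J = carrier R"
    proof (cases "\<one> \<in> J")
      case True
      then show ?thesis using ideal.one_imp_carrier[OF J(1)] by auto
    next
      case False
      with M J have "J \<in> {J. ideal J R \<and> I \<subseteq> J \<and> \<one> \<notin> J}" by auto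
      with max J have "J = M" by blast
      then show ?thesis ..
    qed
  qed
  with M that show thesis by auto
qed

lemma (in ring) maximalideal_is_ideal: "maximalideal M R \<Longrightarrow> ideal M R"
  by (rule maximalideal.axioms(1))

lemma (in ring) maximalideal_subset: "maximalideal M R \<Longrightarrow> M \<subseteq> carrier R"
  using maximalideal_is_ideal additive_subgroup.a_subset ideal.axioms(1) by blast

lemma (in ring) maximalideal_zero_mem: "maximalideal M R \<Longrightarrow> \<zero> \<in> M"
  by (simp add: maximalideal_is_ideal additive_subgroup.zero_closed ideal.axioms(1))

lemma (in ring) maximalideal_add_closed: "\<lbrakk>maximalideal M R; a \<in> M; b \<in> M\<rbrakk> \<Longrightarrow> a \<oplus> b \<in> M"
  by (simp add: maximalideal_is_ideal additive_subgroup.a_closed ideal.axioms(1))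

lemma (in ring) maximalideal_minus_closed: "\<lbrakk>maximalideal M R; a \<in> M\<rbrakk> \<Longrightarrow> \<ominus> a \<in> M"
  by (simp add: maximalideal_is_ideal additive_subgroup.a_inv_closed ideal.axioms(1))

lemma (in ring) maximalideal_l_closed: "\<lbrakk>maximalideal M R; a \<in> M; r \<in> carrier R\<rbrakk> \<Longrightarrow> r \<otimes> a \<in> M"
  by (simp add: maximalideal_is_ideal ideal.I_l_closed)

lemma (in cring) maximalideal_complement_mult:
  assumes "maximalideal M R" "a \<in> carrier R - M" "b \<in> carrier R - M"
  shows "a \<otimes> b \<in> carrier R - M"
  using primeideal.I_prime[OF maximalideal_prime[OF assms(1)]] assms by auto

lemma (in ring) maximalideal_one_notin:
  assumes "maximalideal M R"
  shows "\<one> \<notin> M"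
  using ideal.one_imp_carrier[OF maximalideal.axioms(1)[OF assms]] maximalideal.I_notcarr[OF assms]
  by auto

lemma (in cring) maximalideal_complement_pow:
  assumes "maximalideal M R" "a \<in> carrier R - M"
  shows "a [^] (n::nat) \<in> carrier R - M"
  using maximalideal_complement_mult[OF assms(1)] maximalideal_one_notin assms
  by (induction n) auto

section \<open>Discrete valuation rings\<close>

lemma (in domain) nat_pow_nonzero:
  assumes "t \<in> carrier R" "t \<noteq> \<zero>"
  shows "t [^] (n::nat) \<noteq> \<zero>"
  using assms integral_iff by (induction n) auto

text \<open>If \<open>m\<close> exceeded \<open>n\<close>, cancelling \<open>t^n\<close> would
  exhibit the unit \<open>u\<close> as a multiple of \<open>t\<close>, and \<open>t\<close> would be
  a unit. Using this in both directions makes the exponent in \<open>u t^n\<close> unique.\<close>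

lemma (in domain) nonunit_exponent_le:
  assumes t: "t \<in> carrier R" "t \<noteq> \<zero>" "t \<notin> Units R"
    and u: "u \<in> Units R" "u' \<in> carrier R"
    and eq: "u \<otimes> t [^] (n::nat) = u' \<otimes> t [^] (m::nat)"
  shows "m \<le> n"
proof (rule ccontr)
  assume "\<not> m \<le> n"
  then obtain k where k: "m = n + Suc k"
    by (metis add_Suc_right less_imp_Suc_add not_le)
  have tn: "t [^] n \<noteq> \<zero>" using t by (simp add: nat_pow_nonzero)
  have "t [^] m = t [^] Suc k \<otimes> t [^] n"
    using t k by (metis nat_pow_mult add.commute)
  then have "u \<otimes> t [^] n = (u' \<otimes> t [^] Suc k) \<otimes> t [^] n"
    using eq t u by (simp add: m_assoc)
  then have "u = u' \<otimes> t [^] Suc k"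
    using m_rcancel[OF tn] t u by (metis Units_closed m_closed nat_pow_closed)
  then have "u = t \<otimes> (u' \<otimes> t [^] k)"
    using t u by (simp add: m_ac)
  then have "t \<in> Units R"
    using t u unit_factor[of t "u' \<otimes> t [^] k"] by simp
  with t show False by simp
qed

text \<open>In a principal ideal domain every irreducible factor of \<open>x\<close> generates a
  maximal ideal. By \<open>local\<close> this ideal is \<open>PIdl t\<close>, so each factor is
  \<open>t\<close> up to a unit, and \<open>n\<close> counts the factors.\<close>

lemma (in principal_domain) unit_times_power_if_local:
  assumes t: "t \<in> carrier R"
    and local: "\<And>P. maximalideal P R \<Longrightarrow> P = PIdl t"
    and x: "x \<in> carrier R" "x \<noteq> \<zero>"
  shows "\<exists>n::nat. \<exists>u\<in>Units R. x = u \<otimes> t [^] n"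
proof (cases "x \<in> Units R")
  case True
  then show ?thesis using x by (intro exI[of _ 0] bexI[of _ x]) auto
next
  case False
  then obtain fs where fs: "set fs \<subseteq> carrier (mult_of R)" "wfactors (mult_of R) fs x"
    using factorization_property x by blast
  have "\<exists>n::nat. \<exists>u\<in>Units R. foldr (\<otimes>) gs \<one> = u \<otimes> t [^] n"
    if "set gs \<subseteq> carrier (mult_of R)" "\<forall>p\<in>set gs. irreducible (mult_of R) p" for gs
    using that
  proof (induction gs)
    case Nil
    then show ?case by (intro exI[of _ 0] bexI[of _ \<one>]) auto
  next
    case (Cons p gs)
    then obtain n u where u: "u \<in> Units R" "foldr (\<otimes>) gs \<one> = u \<otimes> t [^] (n::nat)" by auto
    have p: "p \<in> carrier R" "ring_irreducible p"
      using Cons.prems ring_irreducibleI' by auto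
    then have "p \<sim> t"
      using local[OF irreducible_imp_maximalideal[OF p]] associated_iff_same_ideal[OF p(1) t]
      by simp
    then obtain w where w: "w \<in> Units R" "p = w \<otimes> t"
      using ring_associated_iff p t by blast
    have "foldr (\<otimes>) (p # gs) \<one> = (w \<otimes> u) \<otimes> t [^] Suc n"
      using u w t Units_closed[OF w(1)] Units_closed[OF u(1)] by (simp add: m_ac)
    then show ?case using u w by blast
  qed
  then obtain n u where u: "u \<in> Units R" "foldr (\<otimes>) fs \<one> = u \<otimes> t [^] (n::nat)"
    using fs unfolding wfactors_def by blast
  \<comment> \<open>A factorization determines \<open>x\<close> only up to association, which costs
    the further unit \<open>w\<close>.\<close>
  have "x \<sim>\<^bsub>mult_of R\<^esub> foldr (\<otimes>) fs \<one>"
    using fs mult_of.associated_sym unfolding wfactors_def by simp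
  then have "x \<sim> u \<otimes> t [^] n"
    using u t x assoc_iff_assoc_mult by (simp add: Units_closed)
  then obtain w where w: "w \<in> Units R" "x = w \<otimes> (u \<otimes> t [^] n)"
    using ring_associated_iff t x u by (meson Units_closed m_closed nat_pow_closed)
  then have "x = (w \<otimes> u) \<otimes> t [^] n"
    using t u by (simp add: m_assoc Units_closed)
  then show ?thesis using u w by blast
qed

text \<open>Shows that the definite description in \<open>dvr_valuation\<close> is well defined, and
  fixes one generator of the maximal ideal that represents all nonzero elements at once.\<close>

lemma discrete_valuation_ring_uniformizer:
  assumes "discrete_valuation_ring V"
  obtains t where "t \<in> carrier V" "t \<noteq> \<zero>\<^bsub>V\<^esub>" "t \<notin> Units V"
    and "\<And>x. x \<in> carrier V \<Longrightarrow> x \<noteq> \<zero>\<^bsub>V\<^esub> \<Longrightarrow>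
           \<exists>u\<in>Units V. x = u \<otimes>\<^bsub>V\<^esub> t [^]\<^bsub>V\<^esub> dvr_valuation V x"
proof -
  interpret principal_domain V
    using assms unfolding discrete_valuation_ring_def by simp
  obtain P where P: "maximalideal P V" and uniq: "\<And>Q. maximalideal Q V \<Longrightarrow> Q = P"
    using assms unfolding discrete_valuation_ring_def by metis
  obtain t where t: "t \<in> carrier V" "P = PIdl\<^bsub>V\<^esub> t"
    using exists_gen maximalideal.axioms(1)[OF P] by blast
  have nonunit: "t \<notin> Units V"
    using ideal_eq_carrier_iff[OF t(1)] maximalideal.I_notcarr[OF P] t by auto
  \<comment> \<open>If the generator were zero, the zero ideal would be maximal and \<open>V\<close>
    a field, which the definition excludes.\<close>
  have nonzero: "t \<noteq> \<zero>\<^bsub>V\<^esub>"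
  proof
    assume "t = \<zero>\<^bsub>V\<^esub>"
    then have "P = {\<zero>\<^bsub>V\<^esub>}" using t by (auto simp: cgenideal_def intro: exI[of _ "\<zero>\<^bsub>V\<^esub>"])
    then have "field V" using P zeromaximalideal_fieldI by simp
    then show False using assms unfolding discrete_valuation_ring_def by simp
  qed
  have "\<exists>u\<in>Units V. x = u \<otimes>\<^bsub>V\<^esub> t [^]\<^bsub>V\<^esub> dvr_valuation V x"
    if x: "x \<in> carrier V" "x \<noteq> \<zero>\<^bsub>V\<^esub>" for x
  proof -
    obtain n u where u: "u \<in> Units V" "x = u \<otimes>\<^bsub>V\<^esub> t [^]\<^bsub>V\<^esub> (n::nat)"
      using unit_times_power_if_local[OF t(1) _ x] uniq t(2) by blast
    have "dvr_valuation V x = n"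
      unfolding dvr_valuation_def
    proof (rule the_equality)
      show "\<exists>t\<in>carrier V. \<exists>u\<in>Units V. maximalideal (PIdl\<^bsub>V\<^esub> t) V \<and> x = u \<otimes>\<^bsub>V\<^esub> t [^]\<^bsub>V\<^esub> n"
        using t P u by blast
    next
      fix m :: nat
      assume "\<exists>t\<in>carrier V. \<exists>u\<in>Units V. maximalideal (PIdl\<^bsub>V\<^esub> t) V \<and> x = u \<otimes>\<^bsub>V\<^esub> t [^]\<^bsub>V\<^esub> m"
      then obtain t' u' where t': "t' \<in> carrier V" "maximalideal (PIdl\<^bsub>V\<^esub> t') V"
        and u': "u' \<in> Units V" "x = u' \<otimes>\<^bsub>V\<^esub> t' [^]\<^bsub>V\<^esub> m" by blast
      \<comment> \<open>The definition lets the generator vary with the exponent. Another generator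
        is \<open>w t\<close> with \<open>w\<close> a unit, and \<open>w^m\<close> is absorbed into
        the unit cofactor.\<close>
      have "t' \<sim>\<^bsub>V\<^esub> t"
        using associated_iff_same_ideal t' t uniq by blast
      then obtain w where w: "w \<in> Units V" "t' = w \<otimes>\<^bsub>V\<^esub> t"
        using ring_associated_iff t t' by blast
      have W: "u' \<otimes>\<^bsub>V\<^esub> w [^]\<^bsub>V\<^esub> m \<in> Units V"
        using w u' Units_pow_closed by blast
      have "x = (u' \<otimes>\<^bsub>V\<^esub> w [^]\<^bsub>V\<^esub> m) \<otimes>\<^bsub>V\<^esub> t [^]\<^bsub>V\<^esub> m"
        using u' w t by (simp add: nat_pow_distrib m_assoc Units_closed)
      then have "u \<otimes>\<^bsub>V\<^esub> t [^]\<^bsub>V\<^esub> n = (u' \<otimes>\<^bsub>V\<^esub> w [^]\<^bsub>V\<^esub> m) \<otimes>\<^bsub>V\<^esub> t [^]\<^bsub>V\<^esub> m"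
        using u by simp
      then show "m = n"
        using nonunit_exponent_le[OF t(1) nonzero nonunit] u W
        by (metis Units_closed le_antisym)
    qed
    with u show ?thesis by auto
  qed
  with t(1) nonzero nonunit that show thesis by blast
qed

section \<open>Localizations\<close>

context domain
begin

context
  fixes M
  assumes M: "maximalideal M R"
begin

lemma loc_frac_eq_iff:
  assumes "(a, s) \<in> loc_pairs R M" "(b, t) \<in> loc_pairs R M"
  shows "loc_frac R M a s = loc_frac R M b t \<longleftrightarrow> a \<otimes> t = b \<otimes> s"
proof
  assume "loc_frac R M a s = loc_frac R M b t"
  moreover have "(b, t) \<in> loc_frac R M b t"
    using assms unfolding loc_frac_def by auto
  ultimately show "a \<otimes> t = b \<otimes> s" unfolding loc_frac_def by auto
next
  have zero: "\<zero> \<in> M" using maximalideal_zero_mem[OF M] .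
  \<comment> \<open>Cross-multiplied equality is transitive because the middle denominator lies
    outside \<open>M\<close>, hence is nonzero and can be cancelled.\<close>
  have trans: "a \<otimes> r = c \<otimes> s"
    if "(a, s) \<in> loc_pairs R M" "(b, t) \<in> loc_pairs R M" "(c, r) \<in> loc_pairs R M"
      and "a \<otimes> t = b \<otimes> s" "b \<otimes> r = c \<otimes> t" for a s b t c r
  proof -
    have c: "a \<in> carrier R" "b \<in> carrier R" "c \<in> carrier R" "s \<in> carrier R" "t \<in> carrier R"
      "r \<in> carrier R" and t: "t \<noteq> \<zero>"
      using that zero unfolding loc_pairs_def by auto
    have "t \<otimes> (a \<otimes> r) = (a \<otimes> t) \<otimes> r" using c by (simp add: m_ac)
    also have "\<dots> = (b \<otimes> s) \<otimes> r" using that by simp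
    also have "\<dots> = (b \<otimes> r) \<otimes> s" using c by (simp add: m_ac)
    also have "\<dots> = (c \<otimes> t) \<otimes> s" using that by simp
    also have "\<dots> = t \<otimes> (c \<otimes> s)" using c by (simp add: m_ac)
    finally show ?thesis using c t m_lcancel by simp
  qed
  assume eq: "a \<otimes> t = b \<otimes> s"
  show "loc_frac R M a s = loc_frac R M b t"
  proof (intro Set.set_eqI iffI)
    fix p assume "p \<in> loc_frac R M a s"
    then show "p \<in> loc_frac R M b t"
      using trans[OF assms(2,1) _ eq[symmetric]] unfolding loc_frac_def by auto
  next
    fix p assume "p \<in> loc_frac R M b t"
    then show "p \<in> loc_frac R M a s"
      using trans[OF assms(1,2) _ eq] unfolding loc_frac_def by auto
  qed
qed

text \<open>The product is a union over all representatives. Its members coincide by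
  \<open>rep\<close>, and the union is not empty because each class contains its own
  representative.\<close>

lemma loc_frac_mult:
  assumes as: "(a, s) \<in> loc_pairs R M" and bt: "(b, t) \<in> loc_pairs R M"
  shows "loc_frac R M a s \<otimes>\<^bsub>localization R M\<^esub> loc_frac R M b t = loc_frac R M (a \<otimes> b) (s \<otimes> t)"
proof -
  have closed: "(a \<otimes> b, s \<otimes> t) \<in> loc_pairs R M"
    if "(a, s) \<in> loc_pairs R M" "(b, t) \<in> loc_pairs R M" for a s b t
    using that maximalideal_complement_mult[OF M] unfolding loc_pairs_def by blast
  have rep: "loc_frac R M (a' \<otimes> b') (s' \<otimes> t') = loc_frac R M (a \<otimes> b) (s \<otimes> t)"
    if "(a', s') \<in> loc_frac R M a s" "(b', t') \<in> loc_frac R M b t" for a' s' b' t'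
  proof -
    have p: "(a', s') \<in> loc_pairs R M" "(b', t') \<in> loc_pairs R M"
      and e: "a \<otimes> s' = a' \<otimes> s" "b \<otimes> t' = b' \<otimes> t"
      using that unfolding loc_frac_def by auto
    have c: "a \<in> carrier R" "b \<in> carrier R" "s \<in> carrier R" "t \<in> carrier R"
      "a' \<in> carrier R" "b' \<in> carrier R" "s' \<in> carrier R" "t' \<in> carrier R"
      using p assms unfolding loc_pairs_def by auto
    have "(a' \<otimes> b') \<otimes> (s \<otimes> t) = (a' \<otimes> s) \<otimes> (b' \<otimes> t)" using c by (simp add: m_ac)
    also have "\<dots> = (a \<otimes> s') \<otimes> (b \<otimes> t')" using e by simp
    also have "\<dots> = (a \<otimes> b) \<otimes> (s' \<otimes> t')" using c by (simp add: m_ac)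
    finally show ?thesis
      using loc_frac_eq_iff[OF closed[OF p] closed[OF assms]] by simp
  qed
  have mem: "(a, s) \<in> loc_frac R M a s" "(b, t) \<in> loc_frac R M b t"
    using assms unfolding loc_frac_def by auto
  have "(\<Union>(a', s')\<in>loc_frac R M a s. \<Union>(b', t')\<in>loc_frac R M b t.
      loc_frac R M (a' \<otimes> b') (s' \<otimes> t')) = loc_frac R M (a \<otimes> b) (s \<otimes> t)"
    (is "?U = ?F")
  proof (intro equalityI subsetI)
    fix p assume "p \<in> ?U"
    then obtain a' s' b' t' where "(a', s') \<in> loc_frac R M a s" "(b', t') \<in> loc_frac R M b t"
      and "p \<in> loc_frac R M (a' \<otimes> b') (s' \<otimes> t')"
      by auto
    then show "p \<in> ?F" using rep by simp
  next
    fix p assume "p \<in> ?F"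
    then show "p \<in> ?U" using mem by (intro UN_I[of "(a, s)"]) (auto intro!: bexI[of _ "(b, t)"])
  qed
  then show ?thesis by (simp add: localization_def)
qed

lemma loc_frac_pow:
  assumes "(a, s) \<in> loc_pairs R M"
  shows "loc_frac R M a s [^]\<^bsub>localization R M\<^esub> (n::nat) = loc_frac R M (a [^] n) (s [^] n)"
proof (induction n)
  case 0
  then show ?case by (simp add: nat_pow_def) (simp add: localization_def)
next
  case (Suc n)
  have "(a [^] n, s [^] n) \<in> loc_pairs R M"
    using assms maximalideal_complement_pow[OF M] unfolding loc_pairs_def by auto
  then show ?case
    using Suc loc_frac_mult[OF _ assms] by (simp add: nat_pow_def)
qed

text \<open>For \<open>a\<close> outside \<open>M\<close> the inverse of \<open>a / s\<close> is
  \<open>s / a\<close>. Conversely an inverse \<open>b / t\<close> gives \<open>a b = s t\<close>,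
  which lies outside \<open>M\<close>, so \<open>a\<close> does too.\<close>

lemma loc_frac_Units_iff:
  assumes "(a, s) \<in> loc_pairs R M"
  shows "loc_frac R M a s \<in> Units (localization R M) \<longleftrightarrow> a \<notin> M"
proof
  have one: "(\<one>, \<one>) \<in> loc_pairs R M"
    using maximalideal_one_notin[OF M] unfolding loc_pairs_def by auto
  have ideal: "ideal M R" using maximalideal_is_ideal[OF M] .
  have closed: "(a \<otimes> b, s \<otimes> t) \<in> loc_pairs R M"
    if "(a, s) \<in> loc_pairs R M" "(b, t) \<in> loc_pairs R M" for a s b t
    using that maximalideal_complement_mult[OF M] unfolding loc_pairs_def by blast
  {
    assume "loc_frac R M a s \<in> Units (localization R M)"
    then obtain B where "B \<in> carrier (localization R M)"
      and "loc_frac R M a s \<otimes>\<^bsub>localization R M\<^esub> B = \<one>\<^bsub>localization R M\<^esub>"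
      unfolding Units_def by blast
    then obtain b t where bt: "(b, t) \<in> loc_pairs R M"
      and "loc_frac R M a s \<otimes>\<^bsub>localization R M\<^esub> loc_frac R M b t = loc_frac R M \<one> \<one>"
      by (auto simp: localization_def)
    then have "loc_frac R M (a \<otimes> b) (s \<otimes> t) = loc_frac R M \<one> \<one>"
      using loc_frac_mult[OF assms bt] by simp
    then have "(a \<otimes> b) \<otimes> \<one> = \<one> \<otimes> (s \<otimes> t)"
      using loc_frac_eq_iff[OF closed[OF assms bt] one] by simp
    then have "a \<otimes> b = s \<otimes> t"
      using assms bt unfolding loc_pairs_def by simp
    then have "a \<otimes> b \<notin> M"
      using closed[OF assms bt] unfolding loc_pairs_def by simp
    then show "a \<notin> M"
      using ideal.I_r_closed[OF ideal] bt unfolding loc_pairs_def by blast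
  }
  {
    assume "a \<notin> M"
    then have sa: "(s, a) \<in> loc_pairs R M" using assms unfolding loc_pairs_def by simp
    have "loc_frac R M (a \<otimes> s) (s \<otimes> a) = loc_frac R M \<one> \<one>"
      "loc_frac R M (s \<otimes> a) (a \<otimes> s) = loc_frac R M \<one> \<one>"
      using loc_frac_eq_iff[OF closed[OF assms sa] one] loc_frac_eq_iff[OF closed[OF sa assms] one]
        assms by (auto simp: loc_pairs_def m_comm)
    then have "loc_frac R M a s \<otimes>\<^bsub>localization R M\<^esub> loc_frac R M s a = \<one>\<^bsub>localization R M\<^esub>"
      "loc_frac R M s a \<otimes>\<^bsub>localization R M\<^esub> loc_frac R M a s = \<one>\<^bsub>localization R M\<^esub>"
      using loc_frac_mult[OF assms sa] loc_frac_mult[OF sa assms] by (auto simp: localization_def)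
    moreover have "loc_frac R M a s \<in> carrier (localization R M)"
      "loc_frac R M s a \<in> carrier (localization R M)"
      using assms sa by (auto simp: localization_def)
    ultimately show "loc_frac R M a s \<in> Units (localization R M)"
      unfolding Units_def by blast
  }
qed

text \<open>Clearing denominators in \<open>x / 1 = (a / s) (t / r)^n\<close> turns the valuation
  into the equation \<open>(s r^n) x = a t^n\<close> inside \<open>R\<close>, in which only elements
  of \<open>R\<close> occur.\<close>

lemma localization_uniformizer:
  assumes "discrete_valuation_ring (localization R M)"
  obtains t where "t \<in> M" "t \<noteq> \<zero>"
    and "\<And>x. x \<in> carrier R \<Longrightarrow> x \<noteq> \<zero> \<Longrightarrow> \<exists>s\<in>carrier R - M. \<exists>a\<in>carrier R - M.
           s \<otimes> x = a \<otimes> t [^] dvr_valuation (localization R M) (loc_frac R M x \<one>)"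
proof -
  let ?V = "localization R M"
  have one: "(\<one>, \<one>) \<in> loc_pairs R M" and zero1: "(\<zero>, \<one>) \<in> loc_pairs R M"
    using maximalideal_one_notin[OF M] unfolding loc_pairs_def by auto
  obtain T where T: "T \<in> carrier ?V" "T \<noteq> \<zero>\<^bsub>?V\<^esub>" "T \<notin> Units ?V"
    and gen: "\<And>x. x \<in> carrier ?V \<Longrightarrow> x \<noteq> \<zero>\<^bsub>?V\<^esub> \<Longrightarrow>
           \<exists>u\<in>Units ?V. x = u \<otimes>\<^bsub>?V\<^esub> T [^]\<^bsub>?V\<^esub> dvr_valuation ?V x"
    using discrete_valuation_ring_uniformizer[OF assms] by blast
  obtain t r where tr: "(t, r) \<in> loc_pairs R M" and T_eq: "T = loc_frac R M t r"
    using T(1) by (auto simp: localization_def)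
  \<comment> \<open>The uniformizer is a nonunit fraction, so its numerator is in
    \<open>M\<close>.\<close>
  have "t \<in> M" using T(3) loc_frac_Units_iff[OF tr] T_eq by simp
  moreover have "t \<noteq> \<zero>"
    using T(2) loc_frac_eq_iff[OF tr zero1] tr T_eq
    by (auto simp: localization_def loc_pairs_def)
  moreover have "\<exists>s\<in>carrier R - M. \<exists>a\<in>carrier R - M.
      s \<otimes> x = a \<otimes> t [^] dvr_valuation ?V (loc_frac R M x \<one>)"
    if x: "x \<in> carrier R" "x \<noteq> \<zero>" for x
  proof -
    define n where "n = dvr_valuation ?V (loc_frac R M x \<one>)"
    have x1: "(x, \<one>) \<in> loc_pairs R M" using x one unfolding loc_pairs_def by simp
    have "loc_frac R M x \<one> \<in> carrier ?V" "loc_frac R M x \<one> \<noteq> \<zero>\<^bsub>?V\<^esub>"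
      using x1 x loc_frac_eq_iff[OF x1 zero1] by (auto simp: localization_def)
    then obtain U where U: "U \<in> Units ?V" "loc_frac R M x \<one> = U \<otimes>\<^bsub>?V\<^esub> T [^]\<^bsub>?V\<^esub> n"
      using gen n_def by blast
    then have "U \<in> carrier ?V" unfolding Units_def by simp
    then obtain a s where as: "(a, s) \<in> loc_pairs R M" and U_eq: "U = loc_frac R M a s"
      by (auto simp: localization_def)
    have a: "a \<in> carrier R - M"
      using loc_frac_Units_iff[OF as] U U_eq as unfolding loc_pairs_def by simp
    have trn: "(t [^] n, r [^] n) \<in> loc_pairs R M"
      using tr maximalideal_complement_pow[OF M] unfolding loc_pairs_def by auto
    have srn: "s \<otimes> r [^] n \<in> carrier R - M"
      using as trn maximalideal_complement_mult[OF M] unfolding loc_pairs_def by simp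
    then have p: "(a \<otimes> t [^] n, s \<otimes> r [^] n) \<in> loc_pairs R M"
      using a trn unfolding loc_pairs_def by simp
    have "loc_frac R M x \<one> = loc_frac R M (a \<otimes> t [^] n) (s \<otimes> r [^] n)"
      using U U_eq T_eq loc_frac_pow[OF tr] loc_frac_mult[OF as trn] by simp
    then have "x \<otimes> (s \<otimes> r [^] n) = (a \<otimes> t [^] n) \<otimes> \<one>"
      using loc_frac_eq_iff[OF x1 p] by simp
    then have "(s \<otimes> r [^] n) \<otimes> x = a \<otimes> t [^] n"
      using x srn p unfolding loc_pairs_def by (simp add: m_comm)
    then show ?thesis using a srn n_def by blast
  qed
  ultimately show thesis using that by blast
qed

end

end

section \<open>Domains that are locally discrete valuation rings\<close>

text \<open>Keeps from the localizations only what the argument needs: at each \<open>M\<close>,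
  every nonzero \<open>x\<close> is \<open>t M\<close> to the power \<open>v M x\<close>, up to
  factors outside \<open>M\<close>.\<close>

locale local_uniformizers = domain R for R (structure) +
  fixes v :: "'a set \<Rightarrow> 'a \<Rightarrow> nat" and t :: "'a set \<Rightarrow> 'a"
  assumes unif_mem: "maximalideal M R \<Longrightarrow> t M \<in> M"
    and unif_nonzero: "maximalideal M R \<Longrightarrow> t M \<noteq> \<zero>"
    and local_rep: "\<lbrakk>maximalideal M R; x \<in> carrier R; x \<noteq> \<zero>\<rbrakk> \<Longrightarrow>
      \<exists>s\<in>carrier R - M. \<exists>a\<in>carrier R - M. s \<otimes> x = a \<otimes> t M [^] v M x"
begin

lemma unif_closed: "maximalideal M R \<Longrightarrow> t M \<in> carrier R"
  using unif_mem maximalideal_subset by blast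

text \<open>Expresses that the valuation of \<open>x\<close> at \<open>M\<close> is at least
  \<open>k\<close>. Stated by an equation in \<open>R\<close>, it also covers
  \<open>x = \<zero>\<close>, of infinite valuation, which spares case distinctions on sums.\<close>

definition locally_divides :: "'a set \<Rightarrow> nat \<Rightarrow> 'a \<Rightarrow> bool" where
  "locally_divides M k x \<longleftrightarrow> (\<exists>s\<in>carrier R - M. \<exists>a\<in>carrier R. s \<otimes> x = a \<otimes> t M [^] k)"

text \<open>If \<open>k\<close> were larger than \<open>v M x\<close>, comparing the two expressions
  for \<open>x\<close> and cancelling the common power of \<open>t M\<close> would put
  \<open>s a'\<close> into \<open>M\<close>, although both factors lie outside.\<close>

lemma locally_divides_le:
  assumes M: "maximalideal M R" and x: "x \<in> carrier R" "x \<noteq> \<zero>"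
    and div: "locally_divides M k x"
  shows "k \<le> v M x"
proof (rule ccontr)
  assume "\<not> k \<le> v M x"
  then obtain j where k: "k = v M x + Suc j"
    by (metis add_Suc_right less_imp_Suc_add not_le)
  let ?t = "t M" and ?n = "v M x"
  have t: "?t \<in> carrier R" using unif_closed[OF M] .
  obtain s a where s: "s \<in> carrier R - M" and a: "a \<in> carrier R" and sx: "s \<otimes> x = a \<otimes> ?t [^] k"
    using div unfolding locally_divides_def by blast
  obtain s' a' where s': "s' \<in> carrier R - M" "a' \<in> carrier R - M"
    and sx': "s' \<otimes> x = a' \<otimes> ?t [^] ?n"
    using local_rep[OF M x] by blast
  have tk: "?t [^] k = ?t [^] ?n \<otimes> (?t [^] j \<otimes> ?t)"
    using t k nat_pow_mult[of ?t ?n "Suc j"] by simp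
  have "?t [^] ?n \<otimes> (s \<otimes> a') = s \<otimes> (a' \<otimes> ?t [^] ?n)"
    using s s' t by (simp add: m_ac)
  also have "\<dots> = s' \<otimes> (s \<otimes> x)" unfolding sx'[symmetric] using s s' x by (simp add: m_ac)
  also have "\<dots> = ?t [^] ?n \<otimes> ((s' \<otimes> a \<otimes> ?t [^] j) \<otimes> ?t)"
    unfolding sx tk using s s' t a by (simp add: m_ac)
  finally have "s \<otimes> a' = (s' \<otimes> a \<otimes> ?t [^] j) \<otimes> ?t"
    using m_lcancel nat_pow_nonzero[OF t unif_nonzero[OF M]] s s' t a by simp
  then have "s \<otimes> a' \<in> M"
    using maximalideal_l_closed[OF M unif_mem[OF M]] s' a t by simp
  then show False using maximalideal_complement_mult[OF M s s'(2)] by simp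
qed

lemma locally_divides_mono:
  assumes M: "maximalideal M R" and "locally_divides M k x" "j \<le> k"
  shows "locally_divides M j x"
proof -
  obtain s a where s: "s \<in> carrier R - M" "a \<in> carrier R" "s \<otimes> x = a \<otimes> t M [^] k"
    using assms(2) unfolding locally_divides_def by blast
  have "t M [^] k = t M [^] (k - j) \<otimes> t M [^] j"
    using unif_closed[OF M] assms(3) by (simp add: nat_pow_mult)
  then have "s \<otimes> x = (a \<otimes> t M [^] (k - j)) \<otimes> t M [^] j"
    using s unif_closed[OF M] by (simp add: m_assoc)
  then show ?thesis
    using s unif_closed[OF M] unfolding locally_divides_def by blast
qed

lemma locally_divides_if_le:
  assumes M: "maximalideal M R" and x: "x \<in> carrier R" "x \<noteq> \<zero>" and "k \<le> v M x"
  shows "locally_divides M k x"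
proof (rule locally_divides_mono[OF M _ assms(4)])
  show "locally_divides M (v M x) x"
    using local_rep[OF M x] unfolding locally_divides_def by blast
qed

lemma mem_locally_divides:
  assumes M: "maximalideal M R" and y: "y \<in> M"
  shows "locally_divides M 1 y"
proof (cases "y = \<zero>")
  case True
  then show ?thesis
    using maximalideal_one_notin[OF M] unif_closed[OF M] unfolding locally_divides_def
    by (intro bexI[of _ \<one>] bexI[of _ \<zero>]) auto
next
  case False
  have yc: "y \<in> carrier R" using y maximalideal_subset[OF M] by blast
  obtain s a where s: "s \<in> carrier R - M" "a \<in> carrier R - M" "s \<otimes> y = a \<otimes> t M [^] v M y"
    using local_rep[OF M yc False] by blast
  \<comment> \<open>With exponent zero, \<open>s y\<close> would equal \<open>a\<close>, which is
    outside \<open>M\<close> although \<open>y\<close> is in \<open>M\<close>.\<close>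
  have "v M y \<noteq> 0"
  proof
    assume "v M y = 0"
    then have "s \<otimes> y = a" using s by simp
    then show False using maximalideal_l_closed[OF M y] s by auto
  qed
  then show ?thesis using locally_divides_if_le[OF M yc False] by simp
qed

lemma locally_divides_cancel:
  assumes M: "maximalideal M R" and "s \<in> carrier R - M" "x \<in> carrier R"
    and "locally_divides M k (s \<otimes> x)"
  shows "locally_divides M k x"
proof -
  obtain r a where r: "r \<in> carrier R - M" "a \<in> carrier R" "r \<otimes> (s \<otimes> x) = a \<otimes> t M [^] k"
    using assms(4) unfolding locally_divides_def by blast
  then have "(r \<otimes> s) \<otimes> x = a \<otimes> t M [^] k" using assms by (simp add: m_assoc)
  then show ?thesis
    using r maximalideal_complement_mult[OF M r(1) assms(2)] unfolding locally_divides_def by blast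
qed

lemma locally_divides_mult:
  assumes M: "maximalideal M R" and "x \<in> carrier R" "a \<in> carrier R"
    and "locally_divides M k x"
  shows "locally_divides M k (a \<otimes> x)"
proof -
  obtain r b where r: "r \<in> carrier R - M" "b \<in> carrier R" "r \<otimes> x = b \<otimes> t M [^] k"
    using assms(4) unfolding locally_divides_def by blast
  have "r \<otimes> (a \<otimes> x) = a \<otimes> (r \<otimes> x)" using r assms by (simp add: m_ac)
  also have "\<dots> = (a \<otimes> b) \<otimes> t M [^] k"
    using r assms unif_closed[OF M] by (simp add: m_assoc)
  finally show ?thesis
    using r assms unfolding locally_divides_def by blast
qed

text \<open>The ultrametric inequality in subtractive form, obtained over the common denominator
  \<open>r s\<close>.\<close>

lemma locally_divides_diff:
  assumes M: "maximalideal M R" and x: "x \<in> carrier R" and y: "y \<in> carrier R"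
    and "locally_divides M k (x \<oplus> y)" "locally_divides M k x"
  shows "locally_divides M k y"
proof -
  have t: "t M [^] k \<in> carrier R" using unif_closed[OF M] by simp
  obtain r b where r: "r \<in> carrier R - M" "b \<in> carrier R" "r \<otimes> (x \<oplus> y) = b \<otimes> t M [^] k"
    using assms(4) unfolding locally_divides_def by blast
  obtain s c where s: "s \<in> carrier R - M" "c \<in> carrier R" "s \<otimes> x = c \<otimes> t M [^] k"
    using assms(5) unfolding locally_divides_def by blast
  have rs: "r \<otimes> s \<in> carrier R - M" using maximalideal_complement_mult[OF M r(1) s(1)] .
  have rsc: "r \<in> carrier R" "s \<in> carrier R" using r s by auto
  have "(r \<otimes> s) \<otimes> y = s \<otimes> (r \<otimes> (x \<oplus> y)) \<ominus> r \<otimes> (s \<otimes> x)"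
    using rsc x y by algebra
  also have "\<dots> = (s \<otimes> b \<ominus> r \<otimes> c) \<otimes> t M [^] k"
    unfolding r(3) s(3) using r(2) s(2) rsc t by algebra
  finally show ?thesis
    using rs r s rsc unfolding locally_divides_def
    by (intro bexI[of _ "r \<otimes> s"] bexI[of _ "s \<otimes> b \<ominus> r \<otimes> c"]) auto
qed

lemma locally_divides_pow:
  assumes M: "maximalideal M R" and y: "y \<in> M"
  shows "locally_divides M k (y [^] k)"
proof -
  have yc: "y \<in> carrier R" using y maximalideal_subset[OF M] by blast
  have t: "t M \<in> carrier R" using unif_closed[OF M] .
  obtain s a where s: "s \<in> carrier R - M" "a \<in> carrier R" "s \<otimes> y = a \<otimes> t M"
    using mem_locally_divides[OF M y] t unfolding locally_divides_def by auto
  have "s [^] k \<otimes> y [^] k = (s \<otimes> y) [^] k" using s(1) yc by (simp add: nat_pow_distrib)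
  also have "\<dots> = a [^] k \<otimes> t M [^] k" unfolding s(3) using s(2) t by (simp add: nat_pow_distrib)
  finally show ?thesis
    using maximalideal_complement_pow[OF M s(1)] s unfolding locally_divides_def by blast
qed

text \<open>With \<open>n = v M x\<close>, the power \<open>y^n\<close> is locally a multiple of
  \<open>t^n\<close>, and \<open>t^n\<close> is locally \<open>x\<close> up to a unit. So
  \<open>x\<close> divides a power of \<open>y\<close> in the localization at
  \<open>M\<close>.\<close>

lemma pow_locally_multiple:
  assumes M: "maximalideal M R" and y: "y \<in> M" and x: "x \<in> carrier R" "x \<noteq> \<zero>"
  shows "\<exists>n::nat. \<exists>s\<in>carrier R - M. \<exists>c\<in>carrier R. s \<otimes> y [^] n = x \<otimes> c"
proof -
  let ?n = "v M x"
  have yc: "y \<in> carrier R" using y maximalideal_subset[OF M] by blast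
  have t: "t M \<in> carrier R" using unif_closed[OF M] .
  obtain s a where s: "s \<in> carrier R - M" "a \<in> carrier R" "s \<otimes> y [^] ?n = a \<otimes> t M [^] ?n"
    using locally_divides_pow[OF M y] unfolding locally_divides_def by blast
  obtain r b where r: "r \<in> carrier R - M" "b \<in> carrier R - M" "r \<otimes> x = b \<otimes> t M [^] ?n"
    using local_rep[OF M x] by blast
  have "(b \<otimes> s) \<otimes> y [^] ?n = b \<otimes> (s \<otimes> y [^] ?n)" using r s yc by (simp add: m_assoc)
  also have "\<dots> = a \<otimes> (b \<otimes> t M [^] ?n)" using r s t by (simp add: m_ac)
  also have "\<dots> = x \<otimes> (r \<otimes> a)" unfolding r(3)[symmetric] using r(1) s(2) x by (simp add: m_ac)
  finally show ?thesis
    using maximalideal_complement_mult[OF M r(2) s(1)] r(1) s(2) by blast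
qed

end

section \<open>Clopen sets of maximal ideals, given a nonzero element of the Jacobson
  radical\<close>

locale local_uniformizers_jacobson = local_uniformizers +
  fixes x
  assumes x_carrier: "x \<in> carrier R" and x_nonzero: "x \<noteq> \<zero>"
    and x_mem: "\<And>M. maximalideal M R \<Longrightarrow> x \<in> M"
begin

text \<open>The maximal ideals containing a given element form a clopen set. The complementary element
  is found in the ideal of all \<open>a\<close> with \<open>a y\<^sup>n \<in> xR\<close> for some \<open>n\<close>: as \<open>R\<close> is locally of dimension
  one, this ideal is comaximal with \<open>y\<close>.\<close>

lemma complement_exists:
  assumes y: "y \<in> carrier R"
  shows "\<exists>y'\<in>carrier R. \<forall>M. maximalideal M R \<longrightarrow> (y' \<in> M \<longleftrightarrow> y \<notin> M)"
proof -
  define J where "J = {a \<in> carrier R. \<exists>n::nat. \<exists>c\<in>carrier R. a \<otimes> y [^] n = x \<otimes> c}"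
  have J: "ideal J R"
  proof (rule idealI)
    show "ring R" by (rule ring_axioms)
    show "subgroup J (add_monoid R)"
    proof
      show "J \<subseteq> carrier (add_monoid R)" unfolding J_def by auto
      show "\<one>\<^bsub>add_monoid R\<^esub> \<in> J"
        unfolding J_def using y x_carrier by (auto intro!: exI[of _ 0] bexI[of _ \<zero>])
    next
      fix a b assume "a \<in> J" "b \<in> J"
      then obtain n m c d where a: "a \<in> carrier R" "c \<in> carrier R" "a \<otimes> y [^] (n::nat) = x \<otimes> c"
        and b: "b \<in> carrier R" "d \<in> carrier R" "b \<otimes> y [^] (m::nat) = x \<otimes> d"
        unfolding J_def by blast
      have yc: "y [^] n \<in> carrier R" "y [^] m \<in> carrier R" using y by auto
      \<comment> \<open>The two witnesses may use different powers of \<open>y\<close>; the exponent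
        \<open>n + m\<close> serves both.\<close>
      have "(a \<oplus> b) \<otimes> y [^] (n + m) = (a \<oplus> b) \<otimes> (y [^] n \<otimes> y [^] m)"
        using y by (simp add: nat_pow_mult)
      also have "\<dots> = (a \<otimes> y [^] n) \<otimes> y [^] m \<oplus> (b \<otimes> y [^] m) \<otimes> y [^] n"
        using yc a(1) b(1) by algebra
      also have "\<dots> = x \<otimes> (c \<otimes> y [^] m \<oplus> d \<otimes> y [^] n)"
        unfolding a(3) b(3) using yc a(2) b(2) x_carrier by algebra
      finally show "a \<otimes>\<^bsub>add_monoid R\<^esub> b \<in> J"
        unfolding J_def using a b yc by auto
    next
      fix a assume "a \<in> J"
      then obtain n c where a: "a \<in> carrier R" "c \<in> carrier R" "a \<otimes> y [^] (n::nat) = x \<otimes> c"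
        unfolding J_def by blast
      then have "(\<ominus> a) \<otimes> y [^] n = x \<otimes> (\<ominus> c)"
        using y x_carrier by (simp add: l_minus r_minus)
      then have "\<ominus> a \<in> J" unfolding J_def using a by blast
      then show "inv\<^bsub>add_monoid R\<^esub> a \<in> J" by (simp add: a_inv_def)
    qed
  next
    fix a r assume "a \<in> J" and r: "r \<in> carrier R"
    then obtain n c where a: "a \<in> carrier R" "c \<in> carrier R" "a \<otimes> y [^] (n::nat) = x \<otimes> c"
      unfolding J_def by blast
    have "(r \<otimes> a) \<otimes> y [^] n = r \<otimes> (x \<otimes> c)" using a r y by (simp add: m_assoc)
    also have "\<dots> = x \<otimes> (r \<otimes> c)" using a r x_carrier by (simp add: m_ac)
    finally show "r \<otimes> a \<in> J" unfolding J_def using a r by blast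
    then show "a \<otimes> r \<in> J" using a r by (simp add: m_comm)
  qed
  have yI: "ideal (PIdl y) R" using cgenideal_ideal[OF y] .
  have sum: "ideal (J <+>\<^bsub>R\<^esub> PIdl y) R" using add_ideals[OF J yI] .
  have zeros: "\<zero> \<in> J" "\<zero> \<in> PIdl y"
    using J yI additive_subgroup.zero_closed ideal.axioms(1) by blast+
  have "\<one> \<in> J <+>\<^bsub>R\<^esub> PIdl y"
  proof (rule ccontr)
    assume "\<one> \<notin> J <+>\<^bsub>R\<^esub> PIdl y"
    then obtain M where M: "maximalideal M R" "J <+>\<^bsub>R\<^esub> PIdl y \<subseteq> M"
      by (rule exists_maximalideal_containing[OF sum])
    have "\<zero> \<oplus> y \<in> J <+>\<^bsub>R\<^esub> PIdl y"
      using zeros cgenideal_self[OF y] unfolding set_add_def' by blast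
    then have "y \<in> M" using M y by auto
    \<comment> \<open>Since \<open>y \<in> M\<close>, some \<open>s\<close> outside \<open>M\<close>
      multiplies a power of \<open>y\<close> into \<open>xR\<close>. This \<open>s\<close> belongs
      to \<open>J\<close>, against \<open>J\<close> being inside \<open>M\<close>.\<close>
    then obtain n s c where s: "s \<in> carrier R - M" "c \<in> carrier R" "s \<otimes> y [^] (n::nat) = x \<otimes> c"
      using pow_locally_multiple[OF M(1) _ x_carrier x_nonzero] by blast
    then have "s \<in> J" unfolding J_def by blast
    then have "s \<oplus> \<zero> \<in> J <+>\<^bsub>R\<^esub> PIdl y" using zeros unfolding set_add_def' by blast
    then show False using M s by auto
  qed
  then obtain a z where a: "a \<in> J" and z: "z \<in> PIdl y" and one: "\<one> = a \<oplus> z"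
    unfolding set_add_def' by blast
  obtain n c where ac: "a \<in> carrier R" "c \<in> carrier R" "a \<otimes> y [^] (n::nat) = x \<otimes> c"
    using a unfolding J_def by blast
  \<comment> \<open>By \<open>\<one> = a \<oplus> z\<close> no \<open>M\<close> contains both
    \<open>a\<close> and \<open>y\<close>. If \<open>y\<close> is outside \<open>M\<close>, then
    \<open>a y^n = x c\<close> lies in \<open>M\<close> because \<open>x\<close> lies in every
    maximal ideal, and primeness puts \<open>a\<close> into \<open>M\<close>.\<close>
  have "a \<in> M \<longleftrightarrow> y \<notin> M" if M: "maximalideal M R" for M
  proof
    assume "a \<in> M"
    show "y \<notin> M"
    proof
      assume "y \<in> M"
      then have "z \<in> M"
        using z cgenideal_minimal[OF maximalideal_is_ideal[OF M]] by blast
      then have "\<one> \<in> M"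
        using \<open>a \<in> M\<close> one maximalideal_add_closed[OF M] by simp
      then show False using maximalideal_one_notin[OF M] by simp
    qed
  next
    assume "y \<notin> M"
    then have "y [^] n \<in> carrier R - M" using maximalideal_complement_pow[OF M] y by simp
    moreover have "a \<otimes> y [^] n \<in> M"
      using ac ideal.I_r_closed[OF maximalideal_is_ideal[OF M] x_mem[OF M]] by simp
    ultimately show "a \<in> M" using maximalideal_complement_mult[OF M] ac by blast
  qed
  then show ?thesis using ac by blast
qed

text \<open>De Morgan: a product lies in \<open>M\<close> exactly when a factor does, which gives
  unions, and complements are available.\<close>

lemma intersection_exists:
  assumes a: "a \<in> carrier R" and b: "b \<in> carrier R"
  shows "\<exists>c\<in>carrier R. \<forall>M. maximalideal M R \<longrightarrow> (c \<in> M \<longleftrightarrow> a \<in> M \<and> b \<in> M)"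
proof -
  obtain a' where a': "a' \<in> carrier R" "\<forall>M. maximalideal M R \<longrightarrow> (a' \<in> M \<longleftrightarrow> a \<notin> M)"
    using complement_exists[OF a] by blast
  obtain b' where b': "b' \<in> carrier R" "\<forall>M. maximalideal M R \<longrightarrow> (b' \<in> M \<longleftrightarrow> b \<notin> M)"
    using complement_exists[OF b] by blast
  obtain c where c: "c \<in> carrier R" "\<forall>M. maximalideal M R \<longrightarrow> (c \<in> M \<longleftrightarrow> a' \<otimes> b' \<notin> M)"
    using complement_exists[of "a' \<otimes> b'"] a' b' by blast
  have "a' \<otimes> b' \<in> M \<longleftrightarrow> a' \<in> M \<or> b' \<in> M" if M: "maximalideal M R" for M
    using maximalideal_complement_mult[OF M, of a' b'] a'(1) b'(1)
      ideal.I_r_closed[OF maximalideal_is_ideal[OF M]] ideal.I_l_closed[OF maximalideal_is_ideal[OF M]]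
    by blast
  then show ?thesis using a' b' c by blast
qed

section \<open>From a bound on a nonempty clopen set to a bounded nonunit\<close>

text \<open>Where \<open>e\<close> vanishes, \<open>f\<close> is a local unit, so the second summand
  of \<open>d\<close> has valuation at most \<open>n\<close>, while \<open>e^(n+1)\<close> has
  valuation at least \<open>n + 1\<close>; hence they cannot cancel. The ideal \<open>M0\<close>
  keeps \<open>d\<close> from being a unit.\<close>

lemma bounded_element_if_bounded_on:
  assumes e: "e \<in> carrier R" and M0: "maximalideal M0 R" "e \<in> M0"
    and bound: "\<And>M. maximalideal M R \<Longrightarrow> e \<in> M \<Longrightarrow> v M x \<le> n"
  shows "\<exists>d\<in>carrier R. d \<noteq> \<zero> \<and> d \<notin> Units R \<and> (\<forall>M. maximalideal M R \<longrightarrow> v M d \<le> n)"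
proof -
  obtain f where f: "f \<in> carrier R" "\<And>M. maximalideal M R \<Longrightarrow> f \<in> M \<longleftrightarrow> e \<notin> M"
    using complement_exists[OF e] by blast
  \<comment> \<open>\<open>d\<close> has the valuation of \<open>x\<close> where \<open>e\<close> vanishes, and is a unit elsewhere.\<close>
  define d where "d = e [^] Suc n \<oplus> f \<otimes> x"
  have en: "e [^] Suc n \<in> carrier R" and fx: "f \<otimes> x \<in> carrier R"
    using e f x_carrier by auto
  then have d: "d \<in> carrier R" unfolding d_def by simp
  have no_div: "\<not> locally_divides M (Suc n) d" if M: "maximalideal M R" "e \<in> M" for M
  proof
    assume "locally_divides M (Suc n) d"
    then have "locally_divides M (Suc n) (f \<otimes> x)"
      using locally_divides_diff[OF M(1) en fx] locally_divides_pow[OF M] unfolding d_def by blast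
    then have "locally_divides M (Suc n) x"
      using locally_divides_cancel[OF M(1) _ x_carrier] f M by blast
    then show False
      using locally_divides_le[OF M(1) x_carrier x_nonzero] bound[OF M] by fastforce
  qed
  have d0: "d \<noteq> \<zero>"
  proof
    assume "d = \<zero>"
    then have "locally_divides M0 (Suc n) d"
      using maximalideal_one_notin[OF M0(1)] unif_closed[OF M0(1)]
      unfolding locally_divides_def by (intro bexI[of _ \<one>] bexI[of _ \<zero>]) auto
    then show False using no_div M0 by blast
  qed
  \<comment> \<open>Where \<open>e\<close> does not vanish, \<open>f x\<close> still lies in
    \<open>M\<close> but the power of \<open>e\<close> does not, so \<open>d\<close> is outside
    \<open>M\<close>.\<close>
  have mem: "e \<in> M" if M: "maximalideal M R" "d \<in> M" for M
  proof (rule ccontr)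
    assume "e \<notin> M"
    then have "e [^] Suc n \<notin> M"
      using maximalideal_complement_pow[OF M(1), of e "Suc n"] e by blast
    moreover have "f \<otimes> x \<in> M"
      using maximalideal_l_closed[OF M(1) x_mem[OF M(1)]] f by blast
    moreover have "e [^] Suc n = d \<ominus> f \<otimes> x"
      unfolding d_def using en fx by algebra
    ultimately show False
      using M(2) maximalideal_add_closed[OF M(1)] maximalideal_minus_closed[OF M(1)] unfolding a_minus_def by simp
  qed
  have "v M d \<le> n" if M: "maximalideal M R" for M
  proof (cases "d \<in> M")
    case True
    then show ?thesis
      using no_div[OF M mem[OF M True]] locally_divides_if_le[OF M d d0, of "Suc n"] by fastforce
  next
    case False
    \<comment> \<open>An element outside \<open>M\<close> has valuation zero there, so any
      \<open>n\<close> bounds it.\<close>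
    have "\<not> locally_divides M 1 d"
    proof
      assume "locally_divides M 1 d"
      then obtain s a where s: "s \<in> carrier R - M" "a \<in> carrier R" "s \<otimes> d = a \<otimes> t M"
        using unif_closed[OF M] unfolding locally_divides_def by auto
      then have "s \<otimes> d \<in> M"
        using maximalideal_l_closed[OF M unif_mem[OF M]] by simp
      then show False using maximalideal_complement_mult[OF M s(1)] d False by blast
    qed
    then show ?thesis using locally_divides_if_le[OF M d d0, of 1] by fastforce
  qed
  moreover have "d \<notin> Units R"
  proof
    assume unit: "d \<in> Units R"
    have "e [^] n \<otimes> e \<in> M0"
      using maximalideal_l_closed[OF M0] e by simp
    moreover have "f \<otimes> x \<in> M0"
      using maximalideal_l_closed[OF M0(1) x_mem[OF M0(1)]] f by blast
    ultimately have "d \<in> M0"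
      unfolding d_def nat_pow_Suc
      by (rule maximalideal_add_closed[OF M0(1)])
    then have "inv d \<otimes> d \<in> M0"
      using maximalideal_l_closed[OF M0(1)] unit by blast
    then show False using unit maximalideal_one_notin[OF M0(1)] by simp
  qed
  ultimately show ?thesis using d d0 by blast
qed

text \<open>The equation \<open>s x = a t^k\<close> found at one \<open>M\<close> bounds the
  valuation of \<open>x\<close> from below at every \<open>N\<close> containing \<open>t M\<close>
  but not \<open>s\<close>. The element \<open>e'\<close> cuts out this set inside that of
  \<open>e\<close>, and \<open>M\<close> shows that it is nonempty.\<close>

lemma refine_nonempty:
  assumes unbounded: "\<And>e k. e \<in> carrier R \<Longrightarrow> \<exists>M. maximalideal M R \<and> e \<in> M \<Longrightarrow>
      \<exists>M. maximalideal M R \<and> e \<in> M \<and> k \<le> v M x"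
    and e: "e \<in> carrier R" "\<exists>M. maximalideal M R \<and> e \<in> M"
  shows "\<exists>e'\<in>carrier R. (\<exists>M. maximalideal M R \<and> e' \<in> M) \<and>
      (\<forall>M. maximalideal M R \<and> e' \<in> M \<longrightarrow> e \<in> M \<and> k \<le> v M x)"
proof -
  obtain M where M: "maximalideal M R" "e \<in> M" "k \<le> v M x"
    using unbounded[OF e] by blast
  let ?t = "t M"
  have t: "?t \<in> carrier R" using unif_closed[OF M(1)] .
  obtain s a where s: "s \<in> carrier R - M" "a \<in> carrier R" "s \<otimes> x = a \<otimes> ?t [^] k"
    using locally_divides_if_le[OF M(1) x_carrier x_nonzero M(3)]
    unfolding locally_divides_def by blast
  obtain s' where s': "s' \<in> carrier R" "\<And>N. maximalideal N R \<Longrightarrow> s' \<in> N \<longleftrightarrow> s \<notin> N"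
    using complement_exists[of s] s by blast
  obtain g where g: "g \<in> carrier R" "\<And>N. maximalideal N R \<Longrightarrow> g \<in> N \<longleftrightarrow> ?t \<in> N \<and> s' \<in> N"
    using intersection_exists[OF t s'(1)] by blast
  obtain e' where e': "e' \<in> carrier R" "\<And>N. maximalideal N R \<Longrightarrow> e' \<in> N \<longleftrightarrow> e \<in> N \<and> g \<in> N"
    using intersection_exists[OF e(1) g(1)] by blast
  have "e' \<in> M" using e'(2) g(2) s'(2) s M unif_mem by blast
  moreover have "e \<in> N \<and> k \<le> v N x" if N: "maximalideal N R" "e' \<in> N" for N
  proof
    have mem: "e \<in> N" "?t \<in> N" "s \<notin> N" using N e'(2) g(2) s'(2) by blast+
    show "e \<in> N" by fact
    \<comment> \<open>Here \<open>t M\<close> need not be a uniformizer at \<open>N\<close>;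
      membership in \<open>N\<close> suffices for its \<open>k\<close>-th power to have valuation at
      least \<open>k\<close>.\<close>
    have "locally_divides N k (s \<otimes> x)"
      using locally_divides_mult[OF N(1) _ s(2) locally_divides_pow[OF N(1) mem(2)]] t s(3) by simp
    then have "locally_divides N k x"
      using locally_divides_cancel[OF N(1) _ x_carrier] s mem by blast
    then show "k \<le> v N x" using locally_divides_le[OF N(1) x_carrier x_nonzero] by blast
  qed
  ultimately show ?thesis using e' M by blast
qed

text \<open>Compactness of the maximal spectrum, applied to the sets of maximal ideals containing \<open>e k\<close>.\<close>

lemma decreasing_chain_common_maximal:
  assumes e: "\<And>k::nat. e k \<in> carrier R" "\<And>k. \<exists>M. maximalideal M R \<and> e k \<in> M"
    and decr: "\<And>k M. maximalideal M R \<Longrightarrow> e (Suc k) \<in> M \<Longrightarrow> e k \<in> M"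
  shows "\<exists>M. maximalideal M R \<and> (\<forall>k. e k \<in> M)"
proof -
  have le: "e j \<in> M" if "j \<le> k" "maximalideal M R" "e k \<in> M" for j k M
    using that by (induction k rule: dec_induct) (auto intro: decr)
  \<comment> \<open>The elements vanishing on one of the sets given by the \<open>e k\<close>. Since
    these sets decrease, this is an increasing union of ideals; it is proper because no set is
    empty.\<close>
  define I where "I = {y \<in> carrier R. \<exists>k. \<forall>M. maximalideal M R \<and> e k \<in> M \<longrightarrow> y \<in> M}"
  have "ideal I R"
  proof (rule idealI)
    show "ring R" by (rule ring_axioms)
    show "subgroup I (add_monoid R)"
    proof
      show "I \<subseteq> carrier (add_monoid R)" unfolding I_def by auto
      show "\<one>\<^bsub>add_monoid R\<^esub> \<in> I"
        unfolding I_def using maximalideal_zero_mem by simp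
    next
      fix a b assume "a \<in> I" "b \<in> I"
      then obtain j k where a: "a \<in> carrier R" "\<And>M. maximalideal M R \<Longrightarrow> e j \<in> M \<Longrightarrow> a \<in> M"
        and b: "b \<in> carrier R" "\<And>M. maximalideal M R \<Longrightarrow> e k \<in> M \<Longrightarrow> b \<in> M"
        unfolding I_def by blast
      have "a \<oplus> b \<in> M" if M: "maximalideal M R" "e (max j k) \<in> M" for M
      proof -
        have "a \<in> M" "b \<in> M"
          using a(2) b(2) le[of j "max j k" M] le[of k "max j k" M] M by auto
        then show ?thesis using maximalideal_add_closed[OF M(1)] by blast
      qed
      then show "a \<otimes>\<^bsub>add_monoid R\<^esub> b \<in> I" unfolding I_def using a(1) b(1) by auto
    next
      fix a assume "a \<in> I"
      then have "\<ominus> a \<in> I"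
        unfolding I_def using maximalideal_minus_closed by auto
      then show "inv\<^bsub>add_monoid R\<^esub> a \<in> I" by (simp add: a_inv_def)
    qed
  next
    fix a r assume aI: "a \<in> I" and r: "r \<in> carrier R"
    then show "r \<otimes> a \<in> I"
      unfolding I_def using maximalideal_l_closed by (blast intro: m_closed)
    then show "a \<otimes> r \<in> I"
      using aI r unfolding I_def by (simp add: m_comm)
  qed
  moreover have "\<one> \<notin> I"
    unfolding I_def using e(2) maximalideal_one_notin by blast
  ultimately obtain M where M: "maximalideal M R" "I \<subseteq> M"
    by (rule exists_maximalideal_containing)
  moreover have "e k \<in> I" for k unfolding I_def using e(1) by blast
  ultimately show ?thesis by blast
qed

lemma bounded_element_exists:
  "\<exists>d\<in>carrier R. \<exists>n. d \<noteq> \<zero> \<and> d \<notin> Units R \<and> (\<forall>M. maximalideal M R \<longrightarrow> v M d \<le> n)"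
proof (rule ccontr)
  assume neg: "\<not> ?thesis"
  \<comment> \<open>A bound for \<open>x\<close> on a nonempty set of this kind would yield the
    element \<open>d\<close> that \<open>neg\<close> denies.\<close>
  have unbounded: "\<exists>M. maximalideal M R \<and> e \<in> M \<and> k \<le> v M x"
    if "e \<in> carrier R" "\<exists>M. maximalideal M R \<and> e \<in> M" for e k
    using bounded_element_if_bounded_on[OF that(1), of _ k] that neg nat_le_linear by metis
  define P where "P k e \<longleftrightarrow> e \<in> carrier R \<and> (\<exists>M. maximalideal M R \<and> e \<in> M) \<and>
      (\<forall>M. maximalideal M R \<and> e \<in> M \<longrightarrow> k \<le> v M x)" for k e
  obtain M where "maximalideal M R"
    using exists_maximalideal_containing[OF zeroideal] by auto
  \<comment> \<open>The chain starts with \<open>\<zero>\<close>, which lies in all maximal ideals,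
    and the bound \<open>0\<close> is trivial.\<close>
  then have P0: "\<exists>e. P 0 e" unfolding P_def using maximalideal_zero_mem by blast
  have PS: "\<exists>e'. P (Suc k) e' \<and> (\<forall>M. maximalideal M R \<and> e' \<in> M \<longrightarrow> e \<in> M)" if "P k e" for k e
    using refine_nonempty[OF unbounded, of e "Suc k"] that unfolding P_def by blast
  obtain e where e: "\<And>k. P k (e k)"
    and decr: "\<And>k. \<forall>M. maximalideal M R \<and> e (Suc k) \<in> M \<longrightarrow> e k \<in> M"
    using dependent_nat_choice[of P "\<lambda>_ e e'. \<forall>M. maximalideal M R \<and> e' \<in> M \<longrightarrow> e \<in> M", OF P0 PS]
    by blast
  obtain M where "maximalideal M R" "\<And>k. e k \<in> M"
    using decreasing_chain_common_maximal[of e] e decr unfolding P_def by blast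
  \<comment> \<open>The common maximal ideal satisfies every bound of the chain, in particular the
    one just above its own finite value.\<close>
  then have "Suc (v M x) \<le> v M x" using e[of "Suc (v M x)"] unfolding P_def by blast
  then show False by simp
qed

end

section \<open>Return to localizations and principal ideals\<close>

theorem corollary4p9:
  fixes D :: "('a, 'b) ring_scheme"
  assumes "almost_dedekind_domain D"
    and "jacobson_radical D \<noteq> {\<zero>\<^bsub>D\<^esub>}"
  shows "\<not> completely_unbounded D"
proof -
  interpret domain D using assms(1) unfolding almost_dedekind_domain_def by simp
  define v where "v M x = dvr_valuation (localization D M) (loc_frac D M x \<one>\<^bsub>D\<^esub>)" for M x
  have "\<exists>t. t \<in> M \<and> t \<noteq> \<zero>\<^bsub>D\<^esub> \<and> (\<forall>x\<in>carrier D. x \<noteq> \<zero>\<^bsub>D\<^esub> \<longrightarrow>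
      (\<exists>s\<in>carrier D - M. \<exists>a\<in>carrier D - M. s \<otimes>\<^bsub>D\<^esub> x = a \<otimes>\<^bsub>D\<^esub> t [^]\<^bsub>D\<^esub> v M x))"
    if M: "maximalideal M D" for M
  proof -
    have "discrete_valuation_ring (localization D M)"
      using assms(1) M unfolding almost_dedekind_domain_def by simp
    then show ?thesis using localization_uniformizer[OF M] unfolding v_def by metis
  qed
  then obtain t where t: "\<And>M. maximalideal M D \<Longrightarrow> t M \<in> M \<and> t M \<noteq> \<zero>\<^bsub>D\<^esub> \<and>
      (\<forall>x\<in>carrier D. x \<noteq> \<zero>\<^bsub>D\<^esub> \<longrightarrow>
      (\<exists>s\<in>carrier D - M. \<exists>a\<in>carrier D - M. s \<otimes>\<^bsub>D\<^esub> x = a \<otimes>\<^bsub>D\<^esub> t M [^]\<^bsub>D\<^esub> v M x))"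
    by metis
  \<comment> \<open>An intersection over no ideals would be the whole type, so some maximal ideal is
    needed to place elements of the radical in the carrier.\<close>
  obtain M0 where M0: "maximalideal M0 D"
    using exists_maximalideal_containing[OF zeroideal] by auto
  have "\<zero>\<^bsub>D\<^esub> \<in> jacobson_radical D"
    unfolding jacobson_radical_def
    using additive_subgroup.zero_closed ideal.axioms(1) maximalideal.axioms(1) by blast
  then obtain x where x: "x \<in> jacobson_radical D" "x \<noteq> \<zero>\<^bsub>D\<^esub>" using assms(2) by blast
  then have x_mem: "\<And>M. maximalideal M D \<Longrightarrow> x \<in> M" unfolding jacobson_radical_def by blast
  then have xc: "x \<in> carrier D"
    using M0 additive_subgroup.a_subset ideal.axioms(1) maximalideal.axioms(1) by blast
  interpret local_uniformizers_jacobson D v t x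
    by unfold_locales (use t x(2) xc x_mem in simp_all)
  obtain d n where d: "d \<in> carrier D" "d \<noteq> \<zero>\<^bsub>D\<^esub>" "d \<notin> Units D"
    and bound: "\<And>M. maximalideal M D \<Longrightarrow> v M d \<le> n"
    using bounded_element_exists by blast
  let ?I = "PIdl\<^bsub>D\<^esub> d"
  have dI: "d \<in> ?I" using cgenideal_self[OF d(1)] .
  have "\<bar>ideal_valuation D ?I M\<bar> \<le> int n" if M: "maximalideal M D" for M
  proof -
    \<comment> \<open>The valuation of an ideal is a minimum over its nonzero elements, so the
      generator \<open>d\<close> bounds it from above. As a natural number it needs no lower
      estimate.\<close>
    have "(INF x\<in>?I - {\<zero>\<^bsub>D\<^esub>}. v M x) \<le> v M d"
      using dI d by (intro cINF_lower) auto
    also have "\<dots> \<le> n" using bound[OF M] .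
    finally show ?thesis unfolding ideal_valuation_def v_def by simp
  qed
  moreover have "ideal ?I D" "?I \<noteq> {\<zero>\<^bsub>D\<^esub>}" "?I \<noteq> carrier D"
    using cgenideal_ideal[OF d(1)] dI d ideal_eq_carrier_iff[OF d(1)] by auto
  ultimately have "bounded_ideal D ?I" unfolding bounded_ideal_def by blast
  moreover have "principalideal ?I D" using cgenideal_is_principalideal[OF d(1)] .
  ultimately show ?thesis
    using \<open>?I \<noteq> {\<zero>\<^bsub>D\<^esub>}\<close> \<open>?I \<noteq> carrier D\<close> unfolding completely_unbounded_def by blast
qed

end
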